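(* Let $G=(V,E)$ be a finite directed graph (loops and multiple edges allowed) with no sources, i.e. every vertex has indegree at least $1$, and let $n\ge 0$ be an integer. Then $$\kappa(\mathcal{L}^nG)=\kappa(G)\prod_{v\in V}\mathrm{outdeg}(v)^{\,p(n,v)-1}.$$
   Context: A finite directed graph $G=(V,E)$ has source and target maps $\mathtt{s},\mathtt{t}:E\to V$; each edge $e$ is directed from $\mathtt{s}(e)$ to $\mathtt{t}(e)$. $\mathrm{indeg}(v)=\#\{e:\mathtt{t}(e)=v\}$, $\mathrm{outdeg}(v)=\#\{e:\mathtt{s}(e)=v\}$. A vertex $v$ is a source if $\mathrm{indeg}(v)=0$. The iterated line digraph: for $n\ge1$ let $E_n=\{(e_1,\ldots,e_n)\in E^n:\mathtt{s}(e_{i+1})=\mathtt{t}(e_i),\ i=1,\ldots,n-1\}$ be the set of directed paths of $n$ edges in $G$. For $n\ge 1$, $\mathcal{L}^nG=(E_n,E_{n+1})$ has vertex set $E_n$ and edge set $E_{n+1}$, where the edge $(e_1,\ldots,e_{n+1})$ has source $(e_1,\ldots,e_n)$ and target $(e_2,\ldots,e_{n+1})$. Also $E_0=V$ and $\mathcal{L}^0G=G$. $p(n,v)=\#\{(e_1,\ldots,e_n)\in E_n:\mathtt{t}(e_n)=v\}$ is the number of directed paths of $n$ edges in $G$ ending at $v$ (so $p(0,v)=1$). An oriented spanning tree of a directed graph is a subgraph containing all the vertices, having no directed cycles, in which one vertex (the root) has outdegree $0$ and every other vertex has outdegree $1$. $\kappa(H)$ denotes the number of oriented spanning trees of $H$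 (over all possible roots). Convention: $0^0=1$. *)

theory Defs
  imports "Graph_Theory.Graph_Theory"
begin

definition dir_paths :: "('a, 'b) pre_digraph \<Rightarrow> nat \<Rightarrow> 'b list set" where
  "dir_paths G n = {p. length p = n \<and> (\<exists>u v. pre_digraph.awalk G u p v)}"

(* The empty walk is an awalk from v to v for every vertex v, so npaths_to G 0 v = 1. *)
definition npaths_to :: "('a, 'b) pre_digraph \<Rightarrow> nat \<Rightarrow> 'a \<Rightarrow> nat" where
  "npaths_to G n v = card {p. length p = n \<and> (\<exists>u. pre_digraph.awalk G u p v)}"

(* The n-th iterated line digraph (E_n, E_(n+1)), with directed paths as lists of arcs.
   A path with no arcs is a vertex, not the empty list, so the vertices are tagged:
   E_0 consists of the Inl v, and E_n for n >= 1 of the Inr p with p a path of n arcs.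
   For n = 0 this is G with each vertex v written Inl v and each arc e written [e]. *)
definition iter_line_digraph ::
    "nat \<Rightarrow> ('a, 'b) pre_digraph \<Rightarrow> ('a + 'b list, 'b list) pre_digraph" where
  "iter_line_digraph n G =
     \<lparr> verts = (if n = 0 then Inl ` verts G else Inr ` dir_paths G n),
       arcs = dir_paths G (n + 1),
       tail = (\<lambda>p. if n = 0 then Inl (tail G (hd p)) else Inr (butlast p)),
       head = (\<lambda>p. if n = 0 then Inl (head G (hd p)) else Inr (tl p)) \<rparr>"

definition oriented_spanning_tree ::
    "('a, 'b) pre_digraph \<Rightarrow> ('a, 'b) pre_digraph \<Rightarrow> bool" where
  "oriented_spanning_tree T G \<longleftrightarrow>
     spanning T G \<and> \<not> (\<exists>c. pre_digraph.cycle T c) \<and>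
     (\<exists>r \<in> verts T. out_degree T r = 0 \<and> (\<forall>v \<in> verts T - {r}. out_degree T v = 1))"

(* A subgraph in the sense of Graph_Theory inherits the tail and head functions of the
   ambient graph unchanged, so it is determined by its vertices and arcs and is counted once. *)
definition num_oriented_spanning_trees :: "('a, 'b) pre_digraph \<Rightarrow> nat" (\<open>\<kappa>\<close>) where
  "\<kappa> G = card {T. oriented_spanning_tree T G}"

lemma (in wf_digraph) dir_paths_1: "dir_paths G 1 = (\<lambda>e. [e]) ` arcs G"
proof -
  have "p \<in> dir_paths G 1 \<longleftrightarrow> p \<in> (\<lambda>e. [e]) ` arcs G" for p
  proof
    assume "p \<in> dir_paths G 1"
    then show "p \<in> (\<lambda>e. [e]) ` arcs G"
      by (auto simp: dir_paths_def awalk_def length_Suc_conv)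
  next
    assume "p \<in> (\<lambda>e. [e]) ` arcs G"
    then obtain e where e: "e \<in> arcs G" "p = [e]" by blast
    then have "awalk (tail G e) p (head G e)" by (simp add: awalk_def)
    then show "p \<in> dir_paths G 1" using e(2) by (auto simp: dir_paths_def)
  qed
  then show ?thesis by blast
qed

lemma (in wf_digraph) iter_line_digraph_0: "digraph_iso G (iter_line_digraph 0 G)"
proof -
  let ?h = "\<lparr> iso_verts = Inl, iso_arcs = (\<lambda>e. [e]),
    iso_head = (\<lambda>p. Inl (head G (hd p))), iso_tail = (\<lambda>p. Inl (tail G (hd p))) \<rparr>"
  have "digraph_isomorphism ?h"
    by (auto simp: digraph_isomorphism_def inj_on_def wf_digraph_axioms)
  moreover have "iter_line_digraph 0 G = app_iso ?h G"
    using dir_paths_1 by (simp add: iter_line_digraph_def app_iso_def)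
  ultimately show ?thesis unfolding digraph_iso_def by blast
qed

(* Without sources, the truncated subtraction npaths_to G n v - 1 is the true one. *)
lemma (in fin_digraph) npaths_to_pos:
  assumes "\<forall>v \<in> verts G. 1 \<le> in_degree G v" and "v \<in> verts G"
  shows "1 \<le> npaths_to G n v"
proof -
  have ex: "\<exists>p u. length p = n \<and> awalk u p v"
  proof (induction n)
    case 0
    show ?case using assms(2) by (auto simp: awalk_def)
  next
    case (Suc n)
    then obtain p u where p: "length p = n" "awalk u p v" by blast
    then have "u \<in> verts G" by (auto simp: awalk_def)
    then have "in_arcs G u \<noteq> {}" using assms(1) by (force simp: in_degree_def)
    then obtain e where "e \<in> arcs G" "head G e = u" by (meson ex_in_conv in_in_arcs_conv)
    then have "awalk (tail G e) (e # p) v" using p by (auto simp: awalk_def)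
    then show ?case using p(1) by (metis length_Cons)
  qed
  have "{p. length p = n \<and> (\<exists>u. awalk u p v)} \<subseteq> {p. set p \<subseteq> arcs G \<and> length p = n}"
    by (auto simp: awalk_def)
  then have "finite {p. length p = n \<and> (\<exists>u. awalk u p v)}"
    using finite_lists_length_eq[OF finite_arcs] finite_subset by blast
  then show ?thesis using ex unfolding npaths_to_def
    by (metis (mono_tags, lifting) One_nat_def Suc_leI card_gt_0_iff empty_iff mem_Collect_eq)
qed

end

theory Submission
  imports Defs "HOL-Computational_Algebra.Polynomial"
begin

text \<open>
  In a finite digraph \<open>K\<close> let every vertex choose either to be a root or one of its outgoing arcs.
  The choices that close no directed cycle are the spanning forests of \<open>K\<close> oriented towards their
  roots. Let \<open>F(K)\<close> be the polynomial that counts them with weight \<open>x\<close> to the number of roots. An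
  oriented spanning tree is a forest with one root, so \<open>\<kappa> K\<close> is the coefficient of \<open>x\<close> in \<open>F(K)\<close>
  (\<open>num_oriented_spanning_trees_eq_coeff\<close>). All choices together, cyclic ones included, have weight
  \<open>Q(K)\<close>, the product of \<open>x + outdeg v\<close> over all vertices \<open>v\<close>; hence \<open>F(K) / Q(K)\<close> is, for
  \<open>x > 0\<close>, the probability that independent random choices close no cycle. The heart of the proof is
  that this probability is the same for \<open>K\<close> and its line digraph \<open>L\<close>
  (\<open>digraph_forest_poly_line_digraph\<close>): \<open>F(L) Q(K) = Q(L) F(K)\<close>.

  To see this, take the vertices and the arcs of \<open>K\<close> together as nodes. A vertex chooses among its
  outgoing arcs. An arc is either bound, and then leads to its head, or free, and then chooses for
  itself among the arcs that leave its head. If all arcs are bound, this is \<open>K\<close> with its arcs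
  subdivided. If all arcs are free, nothing leads to a vertex any more, so the vertices only contribute
  a factor \<open>Q(K)\<close>, and what remains is \<open>L\<close>. It thus suffices that freeing one arc \<open>e\<close> with head \<open>v\<close>
  multiplies the forest polynomial by \<open>x + outdeg v\<close> (\<open>forest_poly_split\<close>). Fix the choices of all
  other nodes, without a cycle. The options common to \<open>v\<close> and \<open>e\<close> fall into those from which one
  reaches \<open>v\<close>, of weight \<open>p\<close>, those from which one reaches \<open>e\<close>, of weight \<open>q\<close>, and the others, of
  weight \<open>r\<close>; here \<open>p + q + r = x + outdeg v\<close>. As long as \<open>e\<close> is bound, \<open>v\<close> closes no cycle with
  weight \<open>r\<close>. Once \<open>e\<close> is free, the choice of \<open>v\<close> must not lead back to \<open>v\<close>, that of \<open>e\<close> must not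
  lead back to \<open>e\<close>, and the two must not lead to each other, which leaves the weight \<open>(r + q) (r + p) - q p = r (p + q + r)\<close>.

  Write \<open>F n\<close> and \<open>Q n\<close> for the polynomials of the \<open>n\<close>-th iterated line digraph. Telescoping gives
  \<open>F n * Q 0 = Q n * F 0\<close>. The outdegree of a path in the iterated line digraph is the outdegree of its
  last vertex, so \<open>Q n\<close> is the product of \<open>(x + outdeg v) ^ p(n, v)\<close>. Without sources every exponent
  is positive, and \<open>Q 0\<close> cancels. Finally compare the coefficients of \<open>x\<close>: a forest on a nonempty
  vertex set has a root, so the constant term of \<open>F 0\<close> is zero, and only the constant term of the
  product enters.
\<close>

section \<open>Forest polynomials\<close>

text \<open>The option \<open>None\<close> stands for becoming a root.\<close>


definition choices :: "'e set \<Rightarrow> 'e option set" where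
  "choices S = insert None (Some ` S)"

definition choice_weight :: "'e option \<Rightarrow> int poly" where
  "choice_weight a = (if a = None then [:0, 1:] else 1)"

text \<open>The digraph on the nodes that a choice function selects; \<open>\<tau> f\<close> is the node to which the chosen
  \<open>f\<close> leads.\<close>

definition choice_rel :: "('e \<Rightarrow> 'n) \<Rightarrow> 'n set \<Rightarrow> ('n \<Rightarrow> 'e option) \<Rightarrow> ('n \<times> 'n) set" where
  "choice_rel \<tau> X c = {(u, \<tau> f) | u f. u \<in> X \<and> c u = Some f}"

text \<open>The relation \<open>R\<close> holds steps that are present whatever the nodes in \<open>X\<close> choose, such as
  those of the bound arcs.\<close>

definition forest_poly ::
    "'n set \<Rightarrow> ('n \<Rightarrow> 'e set) \<Rightarrow> ('e \<Rightarrow> 'n) \<Rightarrow> ('n \<times> 'n) set \<Rightarrow> int poly" where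
  "forest_poly X C \<tau> R = (\<Sum>c\<in>PiE X (\<lambda>u. choices (C u)).
     of_bool (acyclic (R \<union> choice_rel \<tau> X c)) * (\<Prod>u\<in>X. choice_weight (c u)))"

lemma finite_choices [simp]: "finite (choices S) \<longleftrightarrow> finite S"
  by (simp add: choices_def finite_image_iff)

lemma sum_choice_weight:
  assumes "finite S"
  shows "(\<Sum>a\<in>choices S. choice_weight a) = [:int (card S), 1:]"
proof -
  have "(\<Sum>a\<in>Some ` S. choice_weight a) = of_nat (card S)"
    by (simp add: sum.reindex choice_weight_def)
  then have "(\<Sum>a\<in>choices S. choice_weight a) = [:0, 1:] + of_nat (card S)"
    using assms by (simp add: choices_def choice_weight_def image_iff)
  then show ?thesis by (simp add: of_nat_poly)
qed

lemma choice_rel_insert_upd: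
  assumes "u \<notin> X"
  shows "choice_rel \<tau> (insert u X) (c(u := a)) =
    choice_rel \<tau> X c \<union> (\<lambda>f. (u, \<tau> f)) ` set_option a"
  using assms unfolding choice_rel_def by (cases a) auto

text \<open>Fixing the choice of a single node moves its step into the relation of given steps. All recursions
  below come from this.\<close>

lemma forest_poly_insert:
  assumes "finite X" and "u \<notin> X"
  shows "forest_poly (insert u X) C \<tau> R =
    (\<Sum>a\<in>choices (C u). choice_weight a *
       forest_poly X C \<tau> (R \<union> (\<lambda>f. (u, \<tau> f)) ` set_option a))"
proof -
  have "forest_poly (insert u X) C \<tau> R =
    (\<Sum>(a, c)\<in>choices (C u) \<times> PiE X (\<lambda>u. choices (C u)).
       of_bool (acyclic (R \<union> choice_rel \<tau> (insert u X) (c(u := a)))) *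
       (\<Prod>w\<in>insert u X. choice_weight ((c(u := a)) w)))"
    unfolding forest_poly_def PiE_insert_eq
    by (subst sum.reindex[OF inj_combinator[OF assms(2)]]) (simp add: case_prod_unfold)
  also have "\<dots> = (\<Sum>(a, c)\<in>choices (C u) \<times> PiE X (\<lambda>u. choices (C u)).
       choice_weight a * (of_bool (acyclic (R \<union> (\<lambda>f. (u, \<tau> f)) ` set_option a \<union> choice_rel \<tau> X c)) *
       (\<Prod>w\<in>X. choice_weight (c w))))"
  proof (intro sum.cong refl, clarify)
    fix a :: "'b option" and c :: "'a \<Rightarrow> 'b option"
    have "(\<Prod>w\<in>X. choice_weight ((c(u := a)) w)) = (\<Prod>w\<in>X. choice_weight (c w))"
      using assms(2) by (intro prod.cong) auto
    then show "of_bool (acyclic (R \<union> choice_rel \<tau> (insert u X) (c(u := a)))) *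
       (\<Prod>w\<in>insert u X. choice_weight ((c(u := a)) w)) =
       choice_weight a * (of_bool (acyclic (R \<union> (\<lambda>f. (u, \<tau> f)) ` set_option a \<union> choice_rel \<tau> X c)) *
       (\<Prod>w\<in>X. choice_weight (c w)))"
      using assms by (simp add: choice_rel_insert_upd ac_simps)
  qed
  also have "\<dots> = (\<Sum>a\<in>choices (C u). choice_weight a *
       forest_poly X C \<tau> (R \<union> (\<lambda>f. (u, \<tau> f)) ` set_option a))"
    by (simp add: forest_poly_def sum.cartesian_product[symmetric] sum_distrib_left)
  finally show ?thesis .
qed

section \<open>Splitting a node\<close>

text \<open>Neither \<open>u\<close> nor \<open>w\<close> has a step in \<open>R\<close>, so a cycle uses the new step of \<open>u\<close> alone, of \<open>w\<close>
  alone, or passes through both.\<close>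

lemma acyclic_two_choices:
  assumes "acyclic R" and "u \<notin> Domain R" and "w \<notin> Domain R" and "u \<noteq> w"
  shows "acyclic (R \<union> (\<lambda>f. (w, \<tau> f)) ` set_option b \<union> (\<lambda>f. (u, \<tau> f)) ` set_option a) \<longleftrightarrow>
    \<not> (\<exists>f. b = Some f \<and> (\<tau> f, w) \<in> R\<^sup>*) \<and> \<not> (\<exists>f. a = Some f \<and> (\<tau> f, u) \<in> R\<^sup>*) \<and>
    \<not> ((\<exists>f. a = Some f \<and> (\<tau> f, w) \<in> R\<^sup>*) \<and> (\<exists>f. b = Some f \<and> (\<tau> f, u) \<in> R\<^sup>*))"
proof -
  have "(u, z) \<in> R\<^sup>* \<longleftrightarrow> z = u" "(w, z) \<in> R\<^sup>* \<longleftrightarrow> z = w" for z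
    using assms(2,3) by (auto elim: converse_rtranclE)
  then show ?thesis
    using assms(1,4) by (cases a; cases b) (simp_all add: rtrancl_insert)
qed

text \<open>The weighted count behind the whole proof, with the relation \<open>R\<close> of all other choices fixed. On the
  left \<open>u\<close> and \<open>w\<close> choose independently, on the right \<open>w\<close> is bound to lead to \<open>u\<close>. With \<open>p\<close>, \<open>q\<close>,
  \<open>r\<close> the weights of the options that lead to \<open>u\<close>, to \<open>w\<close>, and to neither, both sides equal
  \<open>r (p + q + r)\<close>. The left one is obtained as \<open>r r + r q + p r\<close>, one summand for each admissible
  combination, so that subtraction is avoided.\<close>

lemma sum_two_choices:
  fixes S :: "'e option set" and wt :: "'e option \<Rightarrow> 'r :: comm_semiring_1"
  assumes "single_valued R"
    and u: "u \<notin> Domain R" and w: "w \<notin> Domain R" and "u \<noteq> w"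
  shows "(\<Sum>b\<in>S. \<Sum>a\<in>S. wt b * wt a * of_bool (acyclic
      (R \<union> (\<lambda>f. (w, \<tau> f)) ` set_option b \<union> (\<lambda>f. (u, \<tau> f)) ` set_option a))) =
    (\<Sum>b\<in>S. wt b) * (\<Sum>a\<in>S. wt a * of_bool (acyclic
      (insert (w, u) R \<union> (\<lambda>f. (u, \<tau> f)) ` set_option a)))"
proof (cases "acyclic R")
  case False
  have cyclic: "\<not> acyclic Q" if "R \<subseteq> Q" for Q
    using False that acyclic_subset by blast
  have "\<not> acyclic (R \<union> A \<union> B)" "\<not> acyclic (insert (w, u) R \<union> A)" for A B
    by (rule cyclic; auto)+
  then show ?thesis by (simp del: acyclic_insert Un_insert_left)
next
  case True
  define reach where "reach z = {a. \<exists>f. a = Some f \<and> (\<tau> f, z) \<in> R\<^sup>*}" for z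
  have no_path: "(u, z) \<in> R\<^sup>* \<longleftrightarrow> z = u" "(w, z) \<in> R\<^sup>* \<longleftrightarrow> z = w" for z
    using u w by (auto elim: converse_rtranclE)
  \<comment> \<open>a single-valued relation leads from a point to at most one of the two dead ends\<close>
  have disj: "a \<notin> reach w" if "a \<in> reach u" for a
  proof
    assume "a \<in> reach w"
    with that obtain f where "(\<tau> f, u) \<in> R\<^sup>*" "(\<tau> f, w) \<in> R\<^sup>*"
      unfolding reach_def by auto
    from single_valued_confluent[OF assms(1) this] show False
      using no_path \<open>u \<noteq> w\<close> by auto
  qed
  \<comment> \<open>indicators of the options leading to \<open>u\<close>, leading to \<open>w\<close>, and leading to neither\<close>
  define i1 i2 i0 where "i1 a = (of_bool (a \<in> reach u) :: 'r)"
    and "i2 a = (of_bool (a \<in> reach w) :: 'r)"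
    and "i0 a = (of_bool (a \<notin> reach u \<and> a \<notin> reach w) :: 'r)" for a
  have merged: "acyclic (insert (w, u) R \<union> (\<lambda>f. (u, \<tau> f)) ` set_option a) \<longleftrightarrow>
      a \<notin> reach u \<and> a \<notin> reach w" for a
    using True no_path \<open>u \<noteq> w\<close>
    by (cases a) (auto simp: rtrancl_insert reach_def)
  have split: "of_bool (acyclic
      (R \<union> (\<lambda>f. (w, \<tau> f)) ` set_option b \<union> (\<lambda>f. (u, \<tau> f)) ` set_option a)) =
      i0 b * i0 a + i0 b * i2 a + i1 b * i0 a" for a b
  proof -
    have "acyclic (R \<union> (\<lambda>f. (w, \<tau> f)) ` set_option b \<union> (\<lambda>f. (u, \<tau> f)) ` set_option a) \<longleftrightarrow>
        b \<notin> reach w \<and> a \<notin> reach u \<and> \<not> (a \<in> reach w \<and> b \<in> reach u)"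
      unfolding acyclic_two_choices[OF True u w \<open>u \<noteq> w\<close>] reach_def mem_Collect_eq ..
    then show ?thesis
      unfolding i0_def i1_def i2_def
      using disj[of a] disj[of b]
      by (cases "a \<in> reach u"; cases "a \<in> reach w"; cases "b \<in> reach u"; cases "b \<in> reach w") simp_all
  qed
  have total: "wt a = wt a * i0 a + wt a * i1 a + wt a * i2 a" for a
    using disj[of a] unfolding i0_def i1_def i2_def
    by (cases "a \<in> reach u"; cases "a \<in> reach w") simp_all
  let ?s = "\<lambda>i. \<Sum>a\<in>S. wt a * i a"
  have "(\<Sum>b\<in>S. \<Sum>a\<in>S. wt b * wt a * (i0 b * i0 a + i0 b * i2 a + i1 b * i0 a)) =
      ?s i0 * ?s i0 + ?s i0 * ?s i2 + ?s i1 * ?s i0"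
    unfolding sum_product sum.distrib[symmetric]
    by (intro sum.cong refl) (simp add: algebra_simps)
  also have "\<dots> = (?s i0 + ?s i1 + ?s i2) * ?s i0"
    by (simp add: algebra_simps)
  also have "?s i0 + ?s i1 + ?s i2 = (\<Sum>a\<in>S. wt a)"
    unfolding sum.distrib[symmetric] total[symmetric] ..
  finally show ?thesis unfolding split merged i0_def .
qed

text \<open>Freeing the node \<open>w\<close>, bound to lead to \<open>u\<close>, by giving it the options of \<open>u\<close>. The condition on the
  domain of \<open>R\<close> says that the nodes with a free choice have no given step, which makes the relation of
  all steps other than those of \<open>u\<close> and \<open>w\<close> single-valued.\<close>

lemma forest_poly_split:
  assumes "finite X" and "u \<notin> X" and "w \<notin> X" and "u \<noteq> w"
    and fin: "finite (C u)" and same: "C w = C u"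
    and R: "single_valued R" and dom: "Domain R \<inter> insert u (insert w X) = {}"
  shows "forest_poly (insert w (insert u X)) C \<tau> R =
    [:int (card (C u)), 1:] * forest_poly (insert u X) C \<tau> (insert (w, u) R)"
proof -
  let ?S = "choices (C u)" and ?P = "PiE X (\<lambda>u. choices (C u))"
  let ?arc = "\<lambda>u a. (\<lambda>f. (u, \<tau> f)) ` set_option a"
  let ?Q = "\<lambda>c. R \<union> choice_rel \<tau> X c"
  have key: "(\<Sum>b\<in>?S. \<Sum>a\<in>?S. choice_weight b * choice_weight a *
        of_bool (acyclic (?Q c \<union> ?arc w b \<union> ?arc u a))) =
      [:int (card (C u)), 1:] * (\<Sum>a\<in>?S. choice_weight a *
        of_bool (acyclic (insert (w, u) (?Q c) \<union> ?arc u a)))" for c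
  proof -
    have "single_valued (?Q c)"
      using R dom unfolding single_valued_def choice_rel_def by auto
    moreover have "u \<notin> Domain (?Q c)" "w \<notin> Domain (?Q c)"
      using dom assms(2,3) unfolding choice_rel_def by auto
    ultimately show ?thesis
      using sum_two_choices[where R = "?Q c" and u = u and w = w and S = ?S
          and wt = choice_weight and \<tau> = \<tau>] fin \<open>u \<noteq> w\<close>
      by (simp add: sum_choice_weight)
  qed
  have "forest_poly (insert w (insert u X)) C \<tau> R =
      (\<Sum>b\<in>?S. \<Sum>a\<in>?S. \<Sum>c\<in>?P. (choice_weight b * choice_weight a *
        of_bool (acyclic (?Q c \<union> ?arc w b \<union> ?arc u a))) * (\<Prod>u\<in>X. choice_weight (c u)))"
    using assms by (simp add: forest_poly_insert same) (simp add: forest_poly_def sum_distrib_left ac_simps)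
  also have "\<dots> = (\<Sum>c\<in>?P. (\<Sum>b\<in>?S. \<Sum>a\<in>?S. choice_weight b * choice_weight a *
        of_bool (acyclic (?Q c \<union> ?arc w b \<union> ?arc u a))) * (\<Prod>u\<in>X. choice_weight (c u)))"
    unfolding sum_distrib_right
    by (rule trans[OF sum.cong[OF refl sum.swap] sum.swap])
  also have "\<dots> = (\<Sum>c\<in>?P. ([:int (card (C u)), 1:] * (\<Sum>a\<in>?S. choice_weight a *
        of_bool (acyclic (insert (w, u) (?Q c) \<union> ?arc u a)))) * (\<Prod>u\<in>X. choice_weight (c u)))"
    unfolding key ..
  also have "\<dots> = [:int (card (C u)), 1:] * (\<Sum>a\<in>?S. \<Sum>c\<in>?P. choice_weight a *
        (of_bool (acyclic (insert (w, u) (?Q c) \<union> ?arc u a)) * (\<Prod>u\<in>X. choice_weight (c u))))"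
    by (subst sum.swap) (simp only: sum_distrib_right sum_distrib_left ac_simps)
  also have "\<dots> = [:int (card (C u)), 1:] * forest_poly (insert u X) C \<tau> (insert (w, u) R)"
    using assms by (simp add: forest_poly_insert) (simp add: forest_poly_def sum_distrib_left Un_ac)
  finally show ?thesis .
qed

text \<open>A node that nothing leads to lies on no cycle, so its choice is unconstrained.\<close>

lemma forest_poly_insert_unreachable:
  assumes "finite X" and "u \<notin> X" and "finite (C u)"
    and "u \<notin> Range R" and "\<And>f. \<tau> f \<noteq> u"
  shows "forest_poly (insert u X) C \<tau> R = [:int (card (C u)), 1:] * forest_poly X C \<tau> R"
proof -
  have "acyclic (R \<union> (\<lambda>f. (u, \<tau> f)) ` set_option a \<union> choice_rel \<tau> X c) \<longleftrightarrow>
      acyclic (R \<union> choice_rel \<tau> X c)" for a c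
  proof -
    have "u \<notin> Range (R \<union> choice_rel \<tau> X c)"
      using assms(4,5) by (fastforce simp: choice_rel_def)
    then have "(\<tau> f, u) \<notin> (R \<union> choice_rel \<tau> X c)\<^sup>*" for f
      using assms(5) by (metis RangeI rtranclE)
    then show ?thesis by (cases a) (auto simp: acyclic_insert)
  qed
  then have "forest_poly X C \<tau> (R \<union> (\<lambda>f. (u, \<tau> f)) ` set_option a) = forest_poly X C \<tau> R" for a
    unfolding forest_poly_def by simp
  then show ?thesis
    using assms(1-3) by (simp add: forest_poly_insert sum_distrib_right[symmetric] sum_choice_weight)
qed

section \<open>Transport of forest polynomials\<close>

text \<open>Renaming nodes and options by bijections. Only acyclicity has to be preserved, not the
  relation itself, so that this also covers the subdivision of the arcs of a digraph.\<close>

lemma forest_poly_reindex: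
  assumes h: "bij_betw h X X'"
    and k: "\<And>u. u \<in> X \<Longrightarrow> bij_betw (k u) (C u) (C' (h u))"
    and acyc: "\<And>c. c \<in> PiE X (\<lambda>u. choices (C u)) \<Longrightarrow>
      acyclic (R' \<union> {(h u, \<tau>' (k u f)) | u f. u \<in> X \<and> c u = Some f}) \<longleftrightarrow>
      acyclic (R \<union> choice_rel \<tau> X c)"
  shows "forest_poly X' C' \<tau>' R' = forest_poly X C \<tau> R"
proof -
  define g where "g = the_inv_into X h"
  have hX: "h u \<in> X'" and gh: "g (h u) = u" if "u \<in> X" for u
    using that h by (auto simp: g_def bij_betw_def the_inv_into_f_f)
  have gX: "g w \<in> X" and hg: "h (g w) = w" if "w \<in> X'" for w
    using that h unfolding g_def bij_betw_def by (auto intro: the_inv_into_into f_the_inv_into_f)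
  define T where "T c = (\<lambda>w\<in>X'. map_option (k (g w)) (c (g w)))" for c
  define T' where "T' c = (\<lambda>u\<in>X. map_option (inv_into (C u) (k u)) (c (h u)))" for c
  have kC: "k u f \<in> C' (h u)" "inv_into (C u) (k u) (k u f) = f" if "u \<in> X" "f \<in> C u" for u f
    using k[OF that(1)] that(2) by (auto simp: bij_betw_def)
  have kC': "inv_into (C u) (k u) f \<in> C u" "k u (inv_into (C u) (k u) f) = f"
    if "u \<in> X" "f \<in> C' (h u)" for u f
    using k[OF that(1)] that(2) by (auto simp: bij_betw_def inv_into_into f_inv_into_f)
  have T'T: "T' (T c) = c" if c: "c \<in> PiE X (\<lambda>u. choices (C u))" for c
  proof
    fix u
    show "T' (T c) u = c u"
    proof (cases "u \<in> X")
      case True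
      then have "c u \<in> choices (C u)" using c by auto
      then show ?thesis using True by (auto simp: T_def T'_def hX gh choices_def kC)
    next
      case False
      then show ?thesis using c by (auto simp: T'_def)
    qed
  qed
  have TT': "T (T' c) = c" if c: "c \<in> PiE X' (\<lambda>u. choices (C' u))" for c
  proof
    fix w
    show "T (T' c) w = c w"
    proof (cases "w \<in> X'")
      case True
      then have "c w \<in> choices (C' (h (g w)))" using c by (auto simp: hg)
      then show ?thesis using True kC'(2)[OF gX[OF True]]
        by (auto simp: T_def T'_def gX hg choices_def)
    next
      case False
      then show ?thesis using c by (auto simp: T_def)
    qed
  qed
  have Tmem: "T c \<in> PiE X' (\<lambda>u. choices (C' u))" if c: "c \<in> PiE X (\<lambda>u. choices (C u))" for c
  proof
    fix w assume w: "w \<in> X'"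
    then have "c (g w) \<in> choices (C (g w))" using c gX by auto
    then show "T c w \<in> choices (C' w)"
      using w kC(1)[OF gX[OF w]] by (auto simp: T_def choices_def hg)
  qed (auto simp: T_def)
  have T'mem: "T' c \<in> PiE X (\<lambda>u. choices (C u))" if c: "c \<in> PiE X' (\<lambda>u. choices (C' u))" for c
  proof
    fix u assume u: "u \<in> X"
    then have "c (h u) \<in> choices (C' (h u))" using c hX by auto
    then show "T' c u \<in> choices (C u)"
      using u kC'(1)[OF u] by (auto simp: T'_def choices_def)
  qed (auto simp: T'_def)
  have rel: "choice_rel \<tau>' X' (T c) = {(h u, \<tau>' (k u f)) | u f. u \<in> X \<and> c u = Some f}" for c
  proof -
    have "choice_rel \<tau>' X' (T c) = {(w, \<tau>' f) | w f. w \<in> h ` X \<and> T c w = Some f}"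
      using h unfolding choice_rel_def bij_betw_def by auto
    also have "\<dots> = {(h u, \<tau>' (k u f)) | u f. u \<in> X \<and> c u = Some f}"
    proof (intro set_eqI iffI)
      fix p assume "p \<in> {(w, \<tau>' f) | w f. w \<in> h ` X \<and> T c w = Some f}"
      then obtain u f where u: "u \<in> X" "T c (h u) = Some f" "p = (h u, \<tau>' f)" by auto
      then obtain f' where "c u = Some f'" "f = k u f'" by (auto simp: T_def hX gh)
      with u show "p \<in> {(h u, \<tau>' (k u f)) | u f. u \<in> X \<and> c u = Some f}" by blast
    next
      fix p assume "p \<in> {(h u, \<tau>' (k u f)) | u f. u \<in> X \<and> c u = Some f}"
      then obtain u f where u: "u \<in> X" "c u = Some f" "p = (h u, \<tau>' (k u f))" by auto
      then have "T c (h u) = Some (k u f)" by (simp add: T_def hX gh)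
      with u show "p \<in> {(w, \<tau>' f) | w f. w \<in> h ` X \<and> T c w = Some f}" by blast
    qed
    finally show ?thesis .
  qed
  have weight: "(\<Prod>w\<in>X'. choice_weight (T c w)) = (\<Prod>u\<in>X. choice_weight (c u))" for c
    unfolding prod.reindex_bij_betw[OF h, symmetric]
    by (intro prod.cong refl) (simp add: T_def hX gh choice_weight_def)
  have "forest_poly X C \<tau> R = forest_poly X' C' \<tau>' R'"
    unfolding forest_poly_def
  proof (rule sum.reindex_bij_witness[where i = T' and j = T])
    fix c assume "c \<in> PiE X (\<lambda>u. choices (C u))"
    then show "of_bool (acyclic (R' \<union> choice_rel \<tau>' X' (T c))) * (\<Prod>w\<in>X'. choice_weight (T c w)) =
        of_bool (acyclic (R \<union> choice_rel \<tau> X c)) * (\<Prod>u\<in>X. choice_weight (c u))"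
      unfolding rel weight by (simp only: acyc)
  qed (simp_all only: T'T TT' Tmem T'mem)
  then show ?thesis ..
qed

lemma acyclic_map_into_trancl:
  assumes "acyclic S" and "\<And>a b. (a, b) \<in> R \<Longrightarrow> (\<phi> a, \<phi> b) \<in> S\<^sup>+"
  shows "acyclic R"
proof -
  have "(\<phi> a, \<phi> b) \<in> S\<^sup>+" if "(a, b) \<in> R\<^sup>+" for a b
    using that by induction (auto intro: assms(2) trancl_trans)
  then show ?thesis
    using assms(1) unfolding acyclic_def by blast
qed

section \<open>Oriented spanning trees as a coefficient\<close>

definition digraph_forest_poly :: "('v, 'e) pre_digraph \<Rightarrow> int poly" where
  "digraph_forest_poly K = forest_poly (verts K) (out_arcs K) (head K) {}"

lemma (in wf_digraph) no_cycle_iff_acyclic: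
  "\<not> (\<exists>c. cycle c) \<longleftrightarrow> acyclic {(tail G f, head G f) | f. f \<in> arcs G}"
proof -
  have "arcs_ends G = {(tail G f, head G f) | f. f \<in> arcs G}"
    by (auto simp: arcs_ends_def arc_to_ends_def)
  moreover have "(\<exists>c. cycle c) \<longleftrightarrow> (\<exists>u. u \<rightarrow>\<^sup>+ u)"
    using closed_w_imp_cycle unfolding reachable1_awalk closed_w_def cycle_def by blast
  ultimately show ?thesis unfolding acyclic_def by auto
qed

lemma prod_choice_weight:
  assumes "finite X"
  shows "(\<Prod>u\<in>X. choice_weight (c u)) = monom 1 (card {u \<in> X. c u = None})"
  using assms
proof (induction X rule: finite_induct)
  case (insert u X)
  have "{w \<in> insert u X. c w = None} =
      (if c u = None then insert u {w \<in> X. c w = None} else {w \<in> X. c w = None})"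
    by auto
  then show ?case
    using insert by (simp add: choice_weight_def monom_Suc)
qed simp

text \<open>Since the roots are counted by the exponent, a coefficient counts the forests with a given number of
  roots.\<close>

lemma coeff_forest_poly:
  assumes "finite X" and "\<And>u. u \<in> X \<Longrightarrow> finite (C u)"
  shows "coeff (forest_poly X C \<tau> R) m = int (card {c \<in> PiE X (\<lambda>u. choices (C u)).
    acyclic (R \<union> choice_rel \<tau> X c) \<and> card {u \<in> X. c u = None} = m})"
proof -
  have "finite (PiE X (\<lambda>u. choices (C u)))"
    using assms by (intro finite_PiE) auto
  moreover have "coeff (forest_poly X C \<tau> R) m = (\<Sum>c\<in>PiE X (\<lambda>u. choices (C u)).
      of_bool (acyclic (R \<union> choice_rel \<tau> X c) \<and> card {u \<in> X. c u = None} = m))"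
    unfolding forest_poly_def coeff_sum
    by (intro sum.cong refl) (simp add: prod_choice_weight assms(1) of_bool_def)
  ultimately show ?thesis by (simp add: Int_def)
qed

context fin_digraph
begin

text \<open>A subgraph that contains all vertices is given by its set of arcs. Outdegree at most 1 means that
  distinct arcs have distinct tails, and the vertices of outdegree 0 are those that are no tail.\<close>

lemma oriented_spanning_tree_iff:
  "oriented_spanning_tree T G \<longleftrightarrow>
    (\<exists>B \<subseteq> arcs G. T = \<lparr>verts = verts G, arcs = B, tail = tail G, head = head G\<rparr> \<and>
      acyclic {(tail G f, head G f) | f. f \<in> B} \<and> inj_on (tail G) B \<and>
      card (verts G - tail G ` B) = 1)"
proof -
  have *: "oriented_spanning_tree \<lparr>verts = verts G, arcs = B, tail = tail G, head = head G\<rparr> G \<longleftrightarrow>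
      acyclic {(tail G f, head G f) | f. f \<in> B} \<and> inj_on (tail G) B \<and>
      card (verts G - tail G ` B) = 1" (is "oriented_spanning_tree ?T G \<longleftrightarrow> _")
    if B: "B \<subseteq> arcs G" for B
  proof -
    have wf: "wf_digraph ?T"
      using B by unfold_locales auto
    have span: "spanning ?T G"
      using B wf unfolding spanning_def subgraph_def compatible_def by (simp add: wf_digraph_axioms)
    have out: "out_arcs ?T v = {f \<in> B. tail G f = v}" for v
      by (simp add: out_arcs_def)
    have finB: "finite B" using B finite_arcs finite_subset by blast
    have deg0: "out_degree ?T v = 0 \<longleftrightarrow> v \<notin> tail G ` B" for v
      using finB by (auto simp: out_degree_def out)
    have "(\<exists>r \<in> verts ?T. out_degree ?T r = 0 \<and> (\<forall>v \<in> verts ?T - {r}. out_degree ?T v = 1)) \<longleftrightarrow>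
        inj_on (tail G) B \<and> card (verts G - tail G ` B) = 1" (is "?L \<longleftrightarrow> ?R")
    proof
      assume ?L
      then obtain r where r: "r \<in> verts G" "r \<notin> tail G ` B"
        and one: "\<And>v. v \<in> verts G - {r} \<Longrightarrow> out_degree ?T v = 1"
        using deg0 by auto
      have "inj_on (tail G) B"
      proof (rule inj_onI)
        fix f f' assume f: "f \<in> B" "f' \<in> B" "tail G f = tail G f'"
        then have "out_degree ?T (tail G f) = 1"
          using B r by (intro one) auto
        then obtain x where "out_arcs ?T (tail G f) = {x}"
          unfolding out_degree_def by (auto simp: card_1_singleton_iff)
        then show "f = f'" using f unfolding out by (metis (mono_tags, lifting) mem_Collect_eq singletonD)
      qed
      moreover have "verts G - tail G ` B = {r}"
        using r one deg0 by (auto simp: image_iff) (metis One_nat_def deg0 image_iff zero_neq_one)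
      ultimately show ?R by simp
    next
      assume ?R
      then obtain r where r: "verts G - tail G ` B = {r}" and inj: "inj_on (tail G) B"
        by (auto simp: card_1_singleton_iff)
      have "out_degree ?T v = 1" if "v \<in> verts G - {r}" for v
      proof -
        have "v \<notin> verts G - tail G ` B" using that r by simp
        with that have "v \<in> tail G ` B" by simp
        then obtain f where f: "f \<in> B" "v = tail G f" by auto
        then have "out_arcs ?T v = {f}" using inj unfolding out by (auto dest: inj_onD)
        then show ?thesis by (simp add: out_degree_def)
      qed
      moreover have "r \<in> verts G" "out_degree ?T r = 0" using r deg0 by auto
      ultimately show ?L by auto
    qed
    then show ?thesis
      using wf_digraph.no_cycle_iff_acyclic[OF wf] span
      unfolding oriented_spanning_tree_def by simp
  qed
  have "\<exists>B \<subseteq> arcs G. T = \<lparr>verts = verts G, arcs = B, tail = tail G, head = head G\<rparr>"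
    if "oriented_spanning_tree T G"
    using that unfolding oriented_spanning_tree_def spanning_def subgraph_def compatible_def
    by (intro exI[of _ "arcs T"]) auto
  then show ?thesis using * by blast
qed

text \<open>A choice function corresponds to the set of chosen arcs; conversely a set of arcs with distinct
  tails determines the choice of each vertex.\<close>

lemma num_oriented_spanning_trees_eq_coeff:
  "int (\<kappa> G) = coeff (digraph_forest_poly G) 1"
proof -
  let ?P = "PiE (verts G) (\<lambda>u. choices (out_arcs G u))"
  let ?A = "{c \<in> ?P. acyclic (choice_rel (head G) (verts G) c) \<and>
      card {u \<in> verts G. c u = None} = 1}"
  let ?Bs = "{B. B \<subseteq> arcs G \<and> acyclic {(tail G f, head G f) | f. f \<in> B} \<and>
      inj_on (tail G) B \<and> card (verts G - tail G ` B) = 1}"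
  let ?tree = "\<lambda>B. \<lparr>verts = verts G, arcs = B, tail = tail G, head = head G\<rparr>"
  define arcs_of where "arcs_of c = {f. \<exists>u \<in> verts G. c u = Some f}" for c :: "'a \<Rightarrow> 'b option"
  define choice_of where "choice_of B = (\<lambda>u \<in> verts G. if u \<in> tail G ` B
      then Some (the_inv_into B (tail G) u) else None)" for B
  have cD: "f \<in> arcs G" "tail G f = u" if "c \<in> ?P" "u \<in> verts G" "c u = Some f" for c u f
  proof -
    have "Some f \<in> choices (out_arcs G u)" using that by (metis PiE_mem)
    then show "f \<in> arcs G" "tail G f = u" by (auto simp: choices_def)
  qed
  have arcs_of_iff: "f \<in> arcs_of c \<longleftrightarrow> f \<in> arcs G \<and> c (tail G f) = Some f" if "c \<in> ?P" for c f
    using cD[OF that] unfolding arcs_of_def by auto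
  have rel: "choice_rel (head G) (verts G) c = {(tail G f, head G f) | f. f \<in> arcs_of c}"
    if "c \<in> ?P" for c
    using cD[OF that] unfolding arcs_of_iff[OF that] choice_rel_def by (auto; metis)
  have roots: "{u \<in> verts G. c u = None} = verts G - tail G ` arcs_of c" if "c \<in> ?P" for c
  proof -
    have "u \<in> tail G ` arcs_of c \<longleftrightarrow> c u \<noteq> None" if u: "u \<in> verts G" for u
    proof
      assume "c u \<noteq> None"
      then obtain f where "c u = Some f" by auto
      then have "f \<in> arcs_of c" "u = tail G f"
        using u cD[OF \<open>c \<in> ?P\<close> u] by (auto simp: arcs_of_def)
      then show "u \<in> tail G ` arcs_of c" by blast
    qed (use arcs_of_iff[OF \<open>c \<in> ?P\<close>] in auto)
    then show ?thesis
      unfolding set_diff_eq by (intro Collect_cong conj_cong refl) simp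
  qed
  have inj: "inj_on (tail G) (arcs_of c)" if "c \<in> ?P" for c
    using arcs_of_iff[OF that] by (auto intro!: inj_onI)
  have choice_of_P: "choice_of B \<in> ?P" and arcs_choice: "arcs_of (choice_of B) = B"
    if "B \<subseteq> arcs G" "inj_on (tail G) B" for B
  proof -
    have hit: "choice_of B (tail G f) = Some f" if "f \<in> B" for f
      using that \<open>B \<subseteq> arcs G\<close> \<open>inj_on (tail G) B\<close>
      by (auto simp: choice_of_def the_inv_into_f_f)
    have miss: "choice_of B u = None" if "u \<in> verts G" "u \<notin> tail G ` B" for u
      using that by (simp add: choice_of_def)
    have "choice_of B u \<in> choices (out_arcs G u)" if u: "u \<in> verts G" for u
    proof (cases "u \<in> tail G ` B")
      case True
      then obtain f where "f \<in> B" "u = tail G f" by auto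
      then show ?thesis using hit \<open>B \<subseteq> arcs G\<close> by (auto simp: choices_def)
    qed (simp add: miss u choices_def)
    then show "choice_of B \<in> ?P" by (auto simp: choice_of_def)
    show "arcs_of (choice_of B) = B"
    proof (intro set_eqI iffI)
      fix f assume "f \<in> arcs_of (choice_of B)"
      then obtain u where u: "u \<in> verts G" "choice_of B u = Some f" by (auto simp: arcs_of_def)
      then obtain f' where "f' \<in> B" "u = tail G f'" using miss by fastforce
      then show "f \<in> B" using u hit by simp
    next
      fix f assume "f \<in> B"
      then show "f \<in> arcs_of (choice_of B)"
        using hit[of f] \<open>B \<subseteq> arcs G\<close> unfolding arcs_of_def
        by (intro CollectI bexI[of _ "tail G f"]) auto
    qed
  qed
  have choice_arcs: "choice_of (arcs_of c) = c" if c: "c \<in> ?P" for c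
  proof
    fix u
    show "choice_of (arcs_of c) u = c u"
    proof (cases "u \<in> verts G \<and> c u \<noteq> None")
      case True
      then obtain f where f: "c u = Some f" "u \<in> verts G" by auto
      then have "f \<in> arcs_of c" "u = tail G f"
        using cD[OF c, of u f] by (auto simp: arcs_of_def)
      then show ?thesis
        using f inj[OF c] by (auto simp: choice_of_def the_inv_into_f_f)
    next
      case False
      then show ?thesis
        using c roots[OF c] by (auto simp: choice_of_def PiE_def extensional_def)
    qed
  qed
  have "bij_betw arcs_of ?A ?Bs"
  proof (rule bij_betw_byWitness[where f' = choice_of])
    show "arcs_of ` ?A \<subseteq> ?Bs"
      using rel roots inj arcs_of_iff by auto
    show "choice_of ` ?Bs \<subseteq> ?A"
      using choice_of_P arcs_choice rel[OF choice_of_P] roots[OF choice_of_P] by auto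
  qed (use choice_arcs arcs_choice in auto)
  then have "card ?A = card ?Bs" by (rule bij_betw_same_card)
  moreover have "{T. oriented_spanning_tree T G} = ?tree ` ?Bs"
    unfolding oriented_spanning_tree_iff by blast
  moreover have "inj_on ?tree ?Bs" by (auto intro: inj_onI)
  ultimately have "\<kappa> G = card ?A"
    unfolding num_oriented_spanning_trees_def by (simp add: card_image)
  then show ?thesis
    unfolding digraph_forest_poly_def
    by (subst coeff_forest_poly) (auto simp: finite_verts)
qed

text \<open>If no vertex is a root, following the choices from any vertex runs into a cycle.\<close>

lemma coeff_0_digraph_forest_poly:
  assumes "verts G \<noteq> {}"
  shows "coeff (digraph_forest_poly G) 0 = 0"
proof -
  have "\<not> acyclic (choice_rel (head G) (verts G) c)"
    if c: "c \<in> PiE (verts G) (\<lambda>u. choices (out_arcs G u))"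
      and roots: "card {u \<in> verts G. c u = None} = 0" for c
  proof
    let ?R = "choice_rel (head G) (verts G) c"
    assume "acyclic ?R"
    have none: "c u \<noteq> None" if "u \<in> verts G" for u
      using roots that finite_verts by auto
    have arc: "f \<in> arcs G" if "u \<in> verts G" "c u = Some f" for u f
    proof -
      have "Some f \<in> choices (out_arcs G u)" using c that by (metis PiE_mem)
      then show ?thesis by (auto simp: choices_def)
    qed
    have "?R \<subseteq> verts G \<times> verts G" using arc by (auto simp: choice_rel_def)
    then have "finite ?R" using finite_verts by (meson finite_SigmaI finite_subset)
    then have "wf (?R\<inverse>)" using \<open>acyclic ?R\<close> by (rule finite_acyclic_wf_converse)
    moreover obtain x where "x \<in> verts G" using assms by blast
    ultimately obtain u where u: "u \<in> verts G" "\<And>v. (v, u) \<in> ?R\<inverse> \<Longrightarrow> v \<notin> verts G"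
      by (rule wfE_min) (use that in simp)
    obtain f where f: "c u = Some f" using none[OF u(1)] by auto
    then have "(u, head G f) \<in> ?R" using u(1) by (auto simp: choice_rel_def)
    then show False
      using u(2)[of "head G f"] arc[OF u(1) f] by simp
  qed
  then show ?thesis
    unfolding digraph_forest_poly_def by (subst coeff_forest_poly) (auto simp: card_eq_0_iff)
qed

end

section \<open>Passing to the line digraph\<close>

definition degree_poly :: "('v, 'e) pre_digraph \<Rightarrow> 'v \<Rightarrow> int poly" where
  "degree_poly K v = [:int (out_degree K v), 1:]"

text \<open>The options of the nodes \<open>Inl v\<close>, for a vertex \<open>v\<close>, and \<open>Inr e\<close>, for a free arc \<open>e\<close>. The free
  arc has the options of its head. Every option is an arc \<open>f\<close> and leads to the node \<open>Inr f\<close>.\<close>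

definition both_choices :: "('v, 'e) pre_digraph \<Rightarrow> 'v + 'e \<Rightarrow> 'e set" where
  "both_choices K = case_sum (out_arcs K) (\<lambda>e. out_arcs K (head K e))"

context fin_digraph
begin

lemma finite_both_choices: "finite (both_choices G u)"
  by (cases u) (auto simp: both_choices_def)

lemma degree_poly_Inl: "[:int (card (both_choices G (Inl v))), 1:] = degree_poly G v"
  by (simp add: both_choices_def degree_poly_def out_degree_def)

text \<open>Here \<open>A\<close> is the set of free arcs. The arcs are freed one at a time by \<open>forest_poly_split\<close>.\<close>

lemma forest_poly_release_arcs:
  assumes "A \<subseteq> arcs G"
  shows "forest_poly (Inl ` verts G \<union> Inr ` A) (both_choices G) Inr
      {(Inr e, Inl (head G e)) | e. e \<in> arcs G - A} =
    (\<Prod>e\<in>A. degree_poly G (head G e)) *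
    forest_poly (Inl ` verts G) (both_choices G) Inr {(Inr e, Inl (head G e)) | e. e \<in> arcs G}"
proof -
  have "finite A" using assms finite_arcs finite_subset by blast
  then show ?thesis
    using assms
  proof (induction A rule: finite_induct)
    case (insert e A)
    let ?R = "\<lambda>A. {(Inr e, Inl (head G e)) | e. e \<in> arcs G - A} :: (('a + 'b) \<times> ('a + 'b)) set"
    let ?v = "head G e"
    let ?X = "Inl ` (verts G - {?v}) \<union> Inr ` A :: ('a + 'b) set"
    have e: "e \<in> arcs G" "?v \<in> verts G" using insert.prems by auto
    have nodes: "insert (Inl ?v) ?X = Inl ` verts G \<union> Inr ` A"
      "insert (Inr e) (insert (Inl ?v) ?X) = Inl ` verts G \<union> Inr ` insert e A"
      using e by auto
    have R: "insert (Inr e, Inl ?v) (?R (insert e A)) = ?R A"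
      using e insert.hyps by auto
    have "forest_poly (insert (Inr e) (insert (Inl ?v) ?X)) (both_choices G) Inr (?R (insert e A)) =
        [:int (card (both_choices G (Inl ?v))), 1:] *
        forest_poly (insert (Inl ?v) ?X) (both_choices G) Inr (insert (Inr e, Inl ?v) (?R (insert e A)))"
    proof (rule forest_poly_split)
      show "finite ?X" using insert.hyps by simp
      show "Inr e \<notin> ?X" using insert.hyps by auto
      show "single_valued (?R (insert e A))" by (auto simp: single_valued_def)
      show "both_choices G (Inr e) = both_choices G (Inl ?v)" by (simp add: both_choices_def)
      show "Domain (?R (insert e A)) \<inter> insert (Inl ?v) (insert (Inr e) ?X) = {}" by auto
    qed (auto simp: finite_both_choices)
    then show ?case
      unfolding nodes R degree_poly_Inl using insert
      by (simp add: mult.assoc)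
  qed simp
qed

text \<open>With all arcs free, every option leads to an arc and never to a vertex.\<close>

lemma forest_poly_drop_vertices:
  assumes "W \<subseteq> verts G"
  shows "forest_poly (Inl ` W \<union> Inr ` arcs G) (both_choices G) Inr {} =
    (\<Prod>v\<in>W. degree_poly G v) * forest_poly (Inr ` arcs G) (both_choices G) Inr {}"
proof -
  have "finite W" using assms finite_verts finite_subset by blast
  then show ?thesis
  proof (induction W rule: finite_induct)
    case (insert v W)
    have "forest_poly (insert (Inl v) (Inl ` W \<union> Inr ` arcs G)) (both_choices G) Inr {} =
        [:int (card (both_choices G (Inl v))), 1:] *
        forest_poly (Inl ` W \<union> Inr ` arcs G) (both_choices G) Inr {}"
      using insert.hyps by (intro forest_poly_insert_unreachable) (auto simp: finite_both_choices)
    then show ?case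
      unfolding degree_poly_Inl using insert by (simp add: mult.assoc)
  qed simp
qed

text \<open>With all arcs bound, a step of \<open>G\<close> becomes two steps, from a vertex to the chosen arc and from there
  to its head. Conversely, a closed walk in the subdivision cannot stay within the single step of a
  bound arc, so it descends to a nonempty closed walk in \<open>G\<close>.\<close>

lemma forest_poly_subdivision:
  "forest_poly (Inl ` verts G) (both_choices G) Inr {(Inr e, Inl (head G e)) | e. e \<in> arcs G} =
    digraph_forest_poly G"
  unfolding digraph_forest_poly_def
proof (rule forest_poly_reindex)
  fix c assume c: "c \<in> PiE (verts G) (\<lambda>u. choices (out_arcs G u))"
  let ?S = "{(Inr e, Inl (head G e)) | e. e \<in> arcs G} \<union>
    {(Inl u, Inr f) | u f. u \<in> verts G \<and> c u = Some f} :: (('a + 'b) \<times> ('a + 'b)) set"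
  let ?R = "choice_rel (head G) (verts G) c"
  let ?\<phi> = "case_sum id (head G)"
  have arc: "f \<in> arcs G" if "u \<in> verts G" "c u = Some f" for u f
  proof -
    have "Some f \<in> choices (out_arcs G u)" using c that by (metis PiE_mem)
    then show ?thesis by (auto simp: choices_def)
  qed
  have "acyclic ?S" if "acyclic ?R"
  proof -
    \<comment> \<open>the second alternative is a walk that consists of the step of a bound arc only\<close>
    have "(?\<phi> x, ?\<phi> y) \<in> ?R\<^sup>+ \<or> (\<exists>e. x = Inr e \<and> y = Inl (head G e))" if "(x, y) \<in> ?S\<^sup>+" for x y
      using that
    proof induction
      case (base y)
      then show ?case by (auto simp: choice_rel_def)
    next
      case (step y z)
      from step.hyps(2) consider
          "\<exists>e. y = Inr e \<and> z = Inl (head G e)"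
        | "y = Inl (?\<phi> y)" "(?\<phi> y, ?\<phi> z) \<in> ?R"
        by (auto simp: choice_rel_def)
      then show ?case
      proof cases
        case 1
        then show ?thesis using step.IH by auto
      next
        case 2
        then show ?thesis using step.IH by (auto intro: trancl_into_trancl)
      qed
    qed
    then show ?thesis
      using that unfolding acyclic_def by fastforce
  qed
  moreover have "acyclic ?R" if "acyclic ?S"
    using that
  proof (rule acyclic_map_into_trancl[where \<phi> = Inl])
    fix u v assume "(u, v) \<in> ?R"
    then obtain f where f: "u \<in> verts G" "c u = Some f" "v = head G f"
      by (auto simp: choice_rel_def)
    then have "(Inl u, Inr f) \<in> ?S" "(Inr f, Inl v) \<in> ?S" using arc by auto
    then show "(Inl u, Inl v) \<in> ?S\<^sup>+" by (meson r_into_trancl trancl_into_trancl)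
  qed
  ultimately show "acyclic ({(Inr e, Inl (head G e)) | e. e \<in> arcs G} \<union>
      {(Inl u, Inr (id f)) | u f. u \<in> verts G \<and> c u = Some f}) \<longleftrightarrow> acyclic ({} \<union> ?R)"
    by auto
qed (auto simp: both_choices_def bij_betw_def inj_on_def)

text \<open>The hypotheses say that \<open>L\<close> is the line digraph of \<open>G\<close> up to renaming: \<open>h\<close> turns arcs into
  vertices, and \<open>k e f\<close> is the arc of \<open>L\<close> that leads from \<open>e\<close> to its successor \<open>f\<close>. The identity
  evaluates in two ways the polynomial of the digraph in which vertices and free arcs coexist.\<close>

lemma digraph_forest_poly_line_digraph:
  assumes verts: "verts L = h ` arcs G" and h: "inj_on h (arcs G)"
    and k: "\<And>e. e \<in> arcs G \<Longrightarrow> bij_betw (k e) (out_arcs G (head G e)) (out_arcs L (h e))"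
    and head: "\<And>e f. e \<in> arcs G \<Longrightarrow> f \<in> out_arcs G (head G e) \<Longrightarrow> head L (k e f) = h f"
  shows "digraph_forest_poly L * (\<Prod>v\<in>verts G. degree_poly G v) =
    (\<Prod>u\<in>verts L. degree_poly L u) * digraph_forest_poly G"
proof -
  have "digraph_forest_poly L = forest_poly (Inr ` arcs G) (both_choices G) Inr {}"
    unfolding digraph_forest_poly_def
  proof (rule forest_poly_reindex)
    show "bij_betw (h \<circ> projr) (Inr ` arcs G) (verts L)"
      using h unfolding verts by (auto simp: bij_betw_def inj_on_def image_image)
    show "bij_betw ((k \<circ> projr) u) (both_choices G u) (out_arcs L ((h \<circ> projr) u))"
      if "u \<in> Inr ` arcs G" for u :: "'a + 'b"
      using that k by (auto simp: both_choices_def)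
    fix c :: "'a + 'b \<Rightarrow> 'b option"
    assume c: "c \<in> PiE (Inr ` arcs G) (\<lambda>u. choices (both_choices G u))"
    let ?R = "choice_rel Inr (Inr ` arcs G) c"
    let ?S = "{((h \<circ> projr) u, head L ((k \<circ> projr) u f)) | u f. u \<in> Inr ` arcs G \<and> c u = Some f}"
    have arc: "f \<in> out_arcs G (head G e)" if "e \<in> arcs G" "c (Inr e) = Some f" for e f
    proof -
      have "Some f \<in> choices (both_choices G (Inr e))" using c that by (metis PiE_mem imageI)
      then show ?thesis by (auto simp: choices_def both_choices_def)
    qed
    have S: "?S = {(h e, h f) | e f. e \<in> arcs G \<and> c (Inr e) = Some f}"
    proof (intro set_eqI iffI)
      fix p assume "p \<in> ?S"
      then obtain u f where "p = ((h \<circ> projr) u, head L ((k \<circ> projr) u f))"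
        "u \<in> Inr ` arcs G" "c u = Some f" by blast
      moreover from this obtain e where "u = Inr e" "e \<in> arcs G" by auto
      ultimately have "p = (h e, h f)" "e \<in> arcs G" "c (Inr e) = Some f"
        using head arc by auto
      then show "p \<in> {(h e, h f) | e f. e \<in> arcs G \<and> c (Inr e) = Some f}" by blast
    next
      fix p assume "p \<in> {(h e, h f) | e f. e \<in> arcs G \<and> c (Inr e) = Some f}"
      then obtain e f where ef: "p = (h e, h f)" "e \<in> arcs G" "c (Inr e) = Some f" by blast
      then have "p = ((h \<circ> projr) (Inr e), head L ((k \<circ> projr) (Inr e) f))"
        using head arc by simp
      with ef show "p \<in> ?S" by blast
    qed
    have "acyclic ?R" if "acyclic ?S"
      using that
    proof (rule acyclic_map_into_trancl[where \<phi> = "h \<circ> projr"])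
      fix a b assume "(a, b) \<in> ?R"
      then obtain e f where "a = Inr e" "b = Inr f" "e \<in> arcs G" "c (Inr e) = Some f"
        by (auto simp: choice_rel_def)
      then have "((h \<circ> projr) a, (h \<circ> projr) b) \<in> ?S"
        unfolding S by auto
      then show "((h \<circ> projr) a, (h \<circ> projr) b) \<in> ?S\<^sup>+" by (rule r_into_trancl)
    qed
    moreover have "acyclic ?S" if "acyclic ?R"
      using that
    proof (rule acyclic_map_into_trancl[where \<phi> = "Inr \<circ> the_inv_into (arcs G) h"])
      fix a b assume "(a, b) \<in> ?S"
      then obtain e f where ef: "a = h e" "b = h f" "e \<in> arcs G" "c (Inr e) = Some f"
        unfolding S by auto
      moreover have "f \<in> arcs G" using arc[OF ef(3,4)] by simp
      ultimately show "((Inr \<circ> the_inv_into (arcs G) h) a, (Inr \<circ> the_inv_into (arcs G) h) b) \<in> ?R\<^sup>+"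
        using h by (auto simp: the_inv_into_f_f choice_rel_def)
    qed
    ultimately show "acyclic ({} \<union> ?S) \<longleftrightarrow> acyclic ({} \<union> ?R)" by auto
  qed
  moreover have "(\<Prod>u\<in>verts L. degree_poly L u) = (\<Prod>e\<in>arcs G. degree_poly G (head G e))"
    unfolding verts prod.reindex[OF h] using bij_betw_same_card[OF k]
    by (simp add: degree_poly_def out_degree_def)
  moreover have "(\<Prod>v\<in>verts G. degree_poly G v) * forest_poly (Inr ` arcs G) (both_choices G) Inr {} =
      (\<Prod>e\<in>arcs G. degree_poly G (head G e)) * digraph_forest_poly G"
    using forest_poly_release_arcs[OF subset_refl]
    unfolding forest_poly_subdivision forest_poly_drop_vertices[OF subset_refl, symmetric]
    by simp
  ultimately show ?thesis by (simp only: mult.commute)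
qed

end

section \<open>Iterated line digraphs\<close>

context wf_digraph
begin

lemma cas_iff_successively:
  assumes "p \<noteq> []"
  shows "cas u p v \<longleftrightarrow> tail G (hd p) = u \<and> successively (\<lambda>e f. head G e = tail G f) p \<and>
    head G (last p) = v"
  using assms
proof (induction p arbitrary: u)
  case (Cons e p)
  show ?case
  proof (cases p)
    case (Cons f q)
    then show ?thesis
      using Cons.IH[of "head G e"] by (simp add: eq_commute)
  qed simp
qed simp

lemma awalk_iff_successively:
  assumes "p \<noteq> []"
  shows "awalk u p v \<longleftrightarrow> set p \<subseteq> arcs G \<and> successively (\<lambda>e f. head G e = tail G f) p \<and>
    tail G (hd p) = u \<and> head G (last p) = v"
proof -
  have "tail G (hd p) \<in> verts G" if "set p \<subseteq> arcs G"
    using subsetD[OF that hd_in_set[OF assms]] by simp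
  then show ?thesis
    unfolding awalk_def cas_iff_successively[OF assms] by auto
qed

lemma mem_dir_paths_iff:
  assumes "n > 0"
  shows "p \<in> dir_paths G n \<longleftrightarrow>
    length p = n \<and> set p \<subseteq> arcs G \<and> successively (\<lambda>e f. head G e = tail G f) p"
proof (cases "p = []")
  case False
  show ?thesis
  proof
    assume "p \<in> dir_paths G n"
    then obtain u v where "length p = n" "awalk u p v" by (auto simp: dir_paths_def)
    then show "length p = n \<and> set p \<subseteq> arcs G \<and> successively (\<lambda>e f. head G e = tail G f) p"
      using awalk_iff_successively[OF False, of u v] by simp
  next
    assume *: "length p = n \<and> set p \<subseteq> arcs G \<and> successively (\<lambda>e f. head G e = tail G f) p"
    then have "awalk (tail G (hd p)) p (head G (last p))"
      using awalk_iff_successively[OF False, of "tail G (hd p)" "head G (last p)"] by simp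
    with * show "p \<in> dir_paths G n" by (auto simp: dir_paths_def)
  qed
next
  case True
  with assms have "length p \<noteq> n" by simp
  then show ?thesis unfolding dir_paths_def by simp
qed

definition path_end :: "'a + 'b list \<Rightarrow> 'a" where
  "path_end = case_sum id (\<lambda>p. head G (last p))"

lemma Cons_mem_dir_paths_iff:
  assumes "p \<noteq> []"
  shows "e # p \<in> dir_paths G (Suc n) \<longleftrightarrow>
    e \<in> arcs G \<and> p \<in> dir_paths G n \<and> head G e = tail G (hd p)"
proof (cases n)
  case 0
  then show ?thesis using assms by (auto simp: mem_dir_paths_iff dir_paths_def)
next
  case (Suc m)
  then show ?thesis using assms by (cases p) (auto simp: mem_dir_paths_iff)
qed

lemma snoc_mem_dir_paths_iff:
  assumes "p \<noteq> []"
  shows "p @ [f] \<in> dir_paths G (Suc n) \<longleftrightarrow>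
    f \<in> arcs G \<and> p \<in> dir_paths G n \<and> head G (last p) = tail G f"
proof (cases n)
  case 0
  then show ?thesis using assms by (auto simp: mem_dir_paths_iff dir_paths_def)
next
  case (Suc m)
  then show ?thesis using assms by (auto simp: mem_dir_paths_iff successively_append_iff)
qed

end

context fin_digraph
begin

lemma finite_dir_paths: "finite (dir_paths G (Suc n))"
  by (rule finite_subset[OF _ finite_lists_length_eq[OF finite_arcs, of "Suc n"]])
     (auto simp: mem_dir_paths_iff)

lemma fin_digraph_iter_line_digraph: "fin_digraph (iter_line_digraph n G)"
proof
  fix p assume "p \<in> arcs (iter_line_digraph n G)"
  then have p: "p \<in> dir_paths G (Suc n)" by (simp add: iter_line_digraph_def)
  then have len: "length p = Suc n" by (simp add: mem_dir_paths_iff)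
  have "tail (iter_line_digraph n G) p \<in> verts (iter_line_digraph n G) \<and>
      head (iter_line_digraph n G) p \<in> verts (iter_line_digraph n G)"
  proof (cases n)
    case 0
    then show ?thesis
      using p by (cases p) (auto simp: iter_line_digraph_def mem_dir_paths_iff)
  next
    case (Suc m)
    obtain e q where eq: "p = e # q" using len by (cases p) auto
    obtain r f where rf: "p = r @ [f]" using len by (cases p rule: rev_cases) auto
    have "q \<noteq> []" "r \<noteq> []" using eq rf len Suc by auto
    have "tl p \<in> dir_paths G n" using p eq \<open>q \<noteq> []\<close> by (simp add: Cons_mem_dir_paths_iff)
    moreover have "butlast p \<in> dir_paths G n" using p rf \<open>r \<noteq> []\<close> by (simp add: snoc_mem_dir_paths_iff)
    ultimately show ?thesis using Suc by (simp add: iter_line_digraph_def)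
  qed
  then show "tail (iter_line_digraph n G) p \<in> verts (iter_line_digraph n G)"
    "head (iter_line_digraph n G) p \<in> verts (iter_line_digraph n G)" by auto
next
  show "finite (verts (iter_line_digraph n G))"
    using finite_dir_paths by (cases n) (simp_all add: iter_line_digraph_def)
  show "finite (arcs (iter_line_digraph n G))"
    using finite_dir_paths[of n] by (simp add: iter_line_digraph_def)
qed

text \<open>An arc that leaves a path is this path extended by one arc of \<open>G\<close>, so the path has the outdegree of
  its last vertex.\<close>

lemma bij_betw_last_out_arcs:
  assumes "u \<in> verts (iter_line_digraph n G)"
  shows "bij_betw last (out_arcs (iter_line_digraph n G) u) (out_arcs G (path_end u))"
proof (cases n)
  case 0
  then obtain v where "u = Inl v" using assms by (auto simp: iter_line_digraph_def)
  then have "out_arcs (iter_line_digraph n G) u = (\<lambda>e. [e]) ` out_arcs G (path_end u)"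
    using 0 dir_paths_1 by (auto simp: iter_line_digraph_def out_arcs_def path_end_def)
  then show ?thesis by (auto simp: bij_betw_def inj_on_def image_image)
next
  case (Suc m)
  then obtain p where p: "u = Inr p" "p \<in> dir_paths G n"
    using assms by (auto simp: iter_line_digraph_def)
  then have "p \<noteq> []" using Suc by (auto simp: mem_dir_paths_iff)
  have "out_arcs (iter_line_digraph n G) u = {q \<in> dir_paths G (Suc n). butlast q = p}"
    using Suc p by (auto simp: iter_line_digraph_def out_arcs_def)
  also have "\<dots> = (\<lambda>f. p @ [f]) ` out_arcs G (path_end u)"
  proof (intro set_eqI iffI)
    fix q assume q: "q \<in> {q \<in> dir_paths G (Suc n). butlast q = p}"
    then have "q = p @ [last q]" using \<open>p \<noteq> []\<close> by (metis (lifting) append_butlast_last_id butlast.simps(1) mem_Collect_eq)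
    with q show "q \<in> (\<lambda>f. p @ [f]) ` out_arcs G (path_end u)"
      using snoc_mem_dir_paths_iff[OF \<open>p \<noteq> []\<close>, of "last q" n] p
      by (intro image_eqI[of _ _ "last q"]) (auto simp: path_end_def)
  next
    fix q assume "q \<in> (\<lambda>f. p @ [f]) ` out_arcs G (path_end u)"
    then show "q \<in> {q \<in> dir_paths G (Suc n). butlast q = p}"
      using snoc_mem_dir_paths_iff[OF \<open>p \<noteq> []\<close>] p by (auto simp: path_end_def)
  qed
  finally show ?thesis by (auto simp: bij_betw_def inj_on_def image_image)
qed

text \<open>Each iterated line digraph is the line digraph of its predecessor: an arc \<open>f\<close> that follows the arc
  \<open>e\<close> overlaps with it in all but the first step of \<open>e\<close>, and putting this step in front of \<open>f\<close>
  gives the longer path that joins \<open>e\<close> to \<open>f\<close>.\<close>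

lemma bij_betw_Cons_out_arcs:
  assumes e: "e \<in> arcs (iter_line_digraph n G)"
  shows "bij_betw ((#) (hd e)) (out_arcs (iter_line_digraph n G) (head (iter_line_digraph n G) e))
    (out_arcs (iter_line_digraph (Suc n) G) (Inr e))"
proof -
  have e': "e \<in> dir_paths G (Suc n)" "e \<noteq> []" "length e = Suc n" "set e \<subseteq> arcs G"
    using e by (auto simp: iter_line_digraph_def mem_dir_paths_iff)
  have "hd e \<in> arcs G" using e'(4) hd_in_set[OF e'(2)] by blast
  have ends: "butlast (hd e # f) = e \<and> head G (hd e) = tail G (hd f) \<longleftrightarrow>
      tail (iter_line_digraph n G) f = head (iter_line_digraph n G) e"
    if f: "f \<in> dir_paths G (Suc n)" for f
  proof -
    have f': "f \<noteq> []" "length f = Suc n" using f by (auto simp: mem_dir_paths_iff)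
    show ?thesis
    proof (cases n)
      case 0
      then obtain a b where "e = [a]" "f = [b]" using e' f' by (auto simp: length_Suc_conv)
      then show ?thesis using 0 by (auto simp: iter_line_digraph_def)
    next
      case (Suc m)
      obtain a b p where ab: "e = a # b # p" using e' Suc by (auto simp: length_Suc_conv)
      obtain c q where c: "f = c # q" using f' by (cases f) auto
      have "q \<noteq> []" using f' Suc c by auto
      moreover have "head G a = tail G b" using e' ab by (simp add: mem_dir_paths_iff)
      ultimately show ?thesis using Suc ab c by (auto simp: iter_line_digraph_def)
    qed
  qed
  have "out_arcs (iter_line_digraph (Suc n) G) (Inr e) =
      {q \<in> dir_paths G (Suc (Suc n)). butlast q = e}"
    by (auto simp: iter_line_digraph_def out_arcs_def)
  also have "\<dots> = (#) (hd e) ` {f \<in> dir_paths G (Suc n).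
      butlast (hd e # f) = e \<and> head G (hd e) = tail G (hd f)}"
  proof (intro set_eqI iffI)
    fix q assume q: "q \<in> {q \<in> dir_paths G (Suc (Suc n)). butlast q = e}"
    then obtain a f where af: "q = a # f" "f \<noteq> []" by (auto simp: mem_dir_paths_iff length_Suc_conv)
    with q have "hd e = a" by auto
    with q af show "q \<in> (#) (hd e) ` {f \<in> dir_paths G (Suc n).
        butlast (hd e # f) = e \<and> head G (hd e) = tail G (hd f)}"
      using Cons_mem_dir_paths_iff[OF af(2), of a "Suc n"] by auto
  next
    fix q assume "q \<in> (#) (hd e) ` {f \<in> dir_paths G (Suc n).
        butlast (hd e # f) = e \<and> head G (hd e) = tail G (hd f)}"
    then obtain f where f: "q = hd e # f" "f \<in> dir_paths G (Suc n)" "butlast (hd e # f) = e"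
      "head G (hd e) = tail G (hd f)" by auto
    moreover from f(2) have "f \<noteq> []" by (auto simp: mem_dir_paths_iff)
    ultimately show "q \<in> {q \<in> dir_paths G (Suc (Suc n)). butlast q = e}"
      using Cons_mem_dir_paths_iff[of f "hd e" "Suc n"] e' \<open>hd e \<in> arcs G\<close> by simp
  qed
  also have "{f \<in> dir_paths G (Suc n). butlast (hd e # f) = e \<and> head G (hd e) = tail G (hd f)} =
      {f \<in> dir_paths G (Suc n).
        tail (iter_line_digraph n G) f = head (iter_line_digraph n G) e}"
    by (intro Collect_cong conj_cong refl ends)
  also have "\<dots> = out_arcs (iter_line_digraph n G) (head (iter_line_digraph n G) e)"
  proof -
    have "arcs (iter_line_digraph n G) = dir_paths G (Suc n)" by (simp add: iter_line_digraph_def)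
    then show ?thesis by (simp only: out_arcs_def)
  qed
  finally show ?thesis by (simp add: bij_betw_def)
qed

text \<open>Group the paths by their last vertex.\<close>

lemma prod_degree_poly_iter_line_digraph:
  "(\<Prod>u\<in>verts (iter_line_digraph n G). degree_poly (iter_line_digraph n G) u) =
    (\<Prod>v\<in>verts G. degree_poly G v ^ npaths_to G n v)"
proof -
  interpret K: fin_digraph "iter_line_digraph n G" by (rule fin_digraph_iter_line_digraph)
  let ?V = "verts (iter_line_digraph n G)"
  have fibre: "card {u \<in> ?V. path_end u = v} = npaths_to G n v" if v: "v \<in> verts G" for v
  proof (cases "n = 0")
    case True
    have "{u \<in> ?V. path_end u = v} = {Inl v}"
      using True v by (auto simp: iter_line_digraph_def path_end_def)
    moreover have "{p. length p = n \<and> (\<exists>u. awalk u p v)} = {[]}"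
      using True v by (auto simp: awalk_def)
    ultimately show ?thesis by (simp add: npaths_to_def)
  next
    case False
    have "{u \<in> ?V. path_end u = v} = Inr ` {p. length p = n \<and> (\<exists>u. awalk u p v)}"
      using False
      by (auto simp: iter_line_digraph_def path_end_def mem_dir_paths_iff awalk_iff_successively)
    then show ?thesis by (simp add: npaths_to_def card_image)
  qed
  have "path_end u \<in> verts G" if "u \<in> ?V" for u
  proof (cases u)
    case (Inr p)
    then have "n > 0" "p \<in> dir_paths G n" using that by (auto simp: iter_line_digraph_def split: if_splits)
    then have "last p \<in> arcs G" using last_in_set[of p] by (auto simp: mem_dir_paths_iff)
    then show ?thesis using Inr by (simp add: path_end_def)
  qed (use that in \<open>auto simp: iter_line_digraph_def path_end_def split: if_splits\<close>)
  then have img: "path_end ` ?V \<subseteq> verts G" by blast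
  have "(\<Prod>u\<in>?V. degree_poly (iter_line_digraph n G) u) = (\<Prod>u\<in>?V. degree_poly G (path_end u))"
    using bij_betw_same_card[OF bij_betw_last_out_arcs]
    by (intro prod.cong refl) (simp add: degree_poly_def out_degree_def)
  also have "\<dots> = (\<Prod>v\<in>verts G. \<Prod>u\<in>{u \<in> ?V. path_end u = v}. degree_poly G (path_end u))"
    by (rule prod.group[OF K.finite_verts finite_verts img, symmetric])
  also have "\<dots> = (\<Prod>v\<in>verts G. degree_poly G v ^ npaths_to G n v)"
    by (intro prod.cong refl) (simp add: fibre[symmetric])
  finally show ?thesis .
qed

lemma digraph_forest_poly_iter_0: "digraph_forest_poly (iter_line_digraph 0 G) = digraph_forest_poly G"
  unfolding digraph_forest_poly_def
proof (rule forest_poly_reindex)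
  show "bij_betw Inl (verts G) (verts (iter_line_digraph 0 G))"
    by (simp add: iter_line_digraph_def bij_betw_def)
  show "bij_betw (\<lambda>e. [e]) (out_arcs G u) (out_arcs (iter_line_digraph 0 G) (Inl u))" for u
    using dir_paths_1 by (auto simp: bij_betw_def inj_on_def out_arcs_def iter_line_digraph_def)
  fix c :: "'a \<Rightarrow> 'b option"
  let ?R = "choice_rel (head G) (verts G) c"
  let ?S = "{(Inl u, head (iter_line_digraph 0 G) [f]) | u f. u \<in> verts G \<and> c u = Some f}"
  have S: "?S = {(Inl u, Inl (head G f)) | u f. u \<in> verts G \<and> c u = Some f}"
    by (simp add: iter_line_digraph_def)
  have "acyclic ?R" if "acyclic ?S"
    using that by (rule acyclic_map_into_trancl[where \<phi> = Inl]) (auto simp: S choice_rel_def)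
  moreover have "acyclic ?S" if "acyclic ?R"
    using that by (rule acyclic_map_into_trancl[where \<phi> = projl]) (auto simp: S choice_rel_def)
  ultimately show "acyclic ({} \<union> ?S) \<longleftrightarrow> acyclic ({} \<union> ?R)" by auto
qed

text \<open>The identities for consecutive line digraphs telescope, since the total weights are nonzero
  polynomials.\<close>

lemma digraph_forest_poly_iter_line_digraph_mult:
  "digraph_forest_poly (iter_line_digraph n G) * (\<Prod>v\<in>verts G. degree_poly G v) =
    (\<Prod>v\<in>verts G. degree_poly G v ^ npaths_to G n v) * digraph_forest_poly G"
proof -
  let ?K = "\<lambda>n. iter_line_digraph n G" and ?F = "\<lambda>n. digraph_forest_poly (iter_line_digraph n G)"
  let ?Q = "\<lambda>n. \<Prod>u\<in>verts (iter_line_digraph n G). degree_poly (iter_line_digraph n G) u"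
  have nz: "?Q n \<noteq> 0" for n
    using fin_digraph.finite_verts[OF fin_digraph_iter_line_digraph[of n]]
    by (simp add: degree_poly_def)
  have step: "?F (Suc n) * ?Q n = ?Q (Suc n) * ?F n" for n
  proof (rule fin_digraph.digraph_forest_poly_line_digraph[OF fin_digraph_iter_line_digraph])
    show "verts (?K (Suc n)) = Inr ` arcs (?K n)" by (simp add: iter_line_digraph_def)
    show "bij_betw ((#) (hd e)) (out_arcs (?K n) (head (?K n) e)) (out_arcs (?K (Suc n)) (Inr e))"
      if "e \<in> arcs (?K n)" for e
      using bij_betw_Cons_out_arcs[OF that] .
  qed (simp_all add: iter_line_digraph_def)
  have "?F n * ?Q 0 = ?Q n * ?F 0"
  proof (induction n)
    case (Suc n)
    have "(?F (Suc n) * ?Q 0) * ?Q n = (?F (Suc n) * ?Q n) * ?Q 0" by (simp only: ac_simps)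
    also have "\<dots> = ?Q (Suc n) * (?F n * ?Q 0)" unfolding step by (simp only: ac_simps)
    also have "\<dots> = (?Q (Suc n) * ?F 0) * ?Q n" unfolding Suc by (simp only: ac_simps)
    finally show ?case using nz by (metis mult_cancel_right)
  qed (simp add: mult.commute)
  moreover have "?Q 0 = (\<Prod>v\<in>verts G. degree_poly G v)"
  proof -
    have "npaths_to G 0 v = 1" if "v \<in> verts G" for v
    proof -
      have "{p. length p = 0 \<and> (\<exists>u. awalk u p v)} = {[]}" using that by (auto simp: awalk_def)
      then show ?thesis by (simp add: npaths_to_def)
    qed
    then show ?thesis by (simp add: prod_degree_poly_iter_line_digraph)
  qed
  ultimately show ?thesis
    by (simp add: prod_degree_poly_iter_line_digraph digraph_forest_poly_iter_0)
qed

lemma digraph_forest_poly_iter_line_digraph: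
  assumes "\<forall>v \<in> verts G. 1 \<le> in_degree G v"
  shows "digraph_forest_poly (iter_line_digraph n G) =
    (\<Prod>v\<in>verts G. degree_poly G v ^ (npaths_to G n v - 1)) * digraph_forest_poly G"
proof -
  let ?Q = "\<Prod>v\<in>verts G. degree_poly G v"
  have "?Q \<noteq> 0" using finite_verts by (simp add: degree_poly_def)
  have "(\<Prod>v\<in>verts G. degree_poly G v ^ npaths_to G n v) =
      (\<Prod>v\<in>verts G. degree_poly G v ^ (npaths_to G n v - 1)) * ?Q"
    unfolding prod.distrib[symmetric]
  proof (intro prod.cong refl)
    fix v assume "v \<in> verts G"
    then have "0 < npaths_to G n v" using npaths_to_pos[OF assms, of v n] by simp
    then show "degree_poly G v ^ npaths_to G n v =
        degree_poly G v ^ (npaths_to G n v - 1) * degree_poly G v"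
      by (simp only: power_minus_mult)
  qed
  then have "digraph_forest_poly (iter_line_digraph n G) * ?Q =
      ((\<Prod>v\<in>verts G. degree_poly G v ^ (npaths_to G n v - 1)) * digraph_forest_poly G) * ?Q"
    unfolding digraph_forest_poly_iter_line_digraph_mult by (simp only: ac_simps)
  with \<open>?Q \<noteq> 0\<close> show ?thesis by (simp only: mult_cancel_right) blast
qed

end

theorem theorem4p1:
  fixes G :: "('a, 'b) pre_digraph" and n :: nat
  assumes "fin_digraph G"
    and no_sources: "\<forall>v \<in> verts G. 1 \<le> in_degree G v"
  shows "\<kappa> (iter_line_digraph n G) =
    \<kappa> G * (\<Prod>v \<in> verts G. out_degree G v ^ (npaths_to G n v - 1))"
proof -
  interpret fin_digraph G by fact
  let ?P = "\<Prod>v\<in>verts G. degree_poly G v ^ (npaths_to G n v - 1)"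
  have "int (\<kappa> (iter_line_digraph n G)) = coeff (?P * digraph_forest_poly G) 1"
    using fin_digraph.num_oriented_spanning_trees_eq_coeff[OF fin_digraph_iter_line_digraph]
    by (simp add: digraph_forest_poly_iter_line_digraph[OF no_sources])
  also have "\<dots> = coeff ?P 0 * coeff (digraph_forest_poly G) 1 +
      coeff ?P 1 * coeff (digraph_forest_poly G) 0"
    by (simp only: coeff_mult One_nat_def sum.atMost_Suc) simp
  also have "coeff ?P 1 * coeff (digraph_forest_poly G) 0 = 0"
    using coeff_0_digraph_forest_poly by (cases "verts G = {}") auto
  also have "coeff ?P 0 = int (\<Prod>v \<in> verts G. out_degree G v ^ (npaths_to G n v - 1))"
    by (simp add: poly_0_coeff_0[symmetric] poly_prod degree_poly_def)
  finally have "int (\<kappa> (iter_line_digraph n G)) =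
      int (\<kappa> G * (\<Prod>v \<in> verts G. out_degree G v ^ (npaths_to G n v - 1)))"
    unfolding num_oriented_spanning_trees_eq_coeff[symmetric] of_nat_mult
    by (simp only: add_0_right mult.commute)
  then show ?thesis by (simp only: of_nat_eq_iff)
qed

end
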